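(* Let $\underline{P}_i$ be a coherent lower prevision on $\mathcal{L}(\mathcal{X}_i)$, with conjugate $\overline{P}_i$, for $i=1,\dots,n$. Let $\Omega=\mathcal{X}_1\times\dots\times\mathcal{X}_n$ carry the total preorder $\preceq$ induced by $Z(x_1,\dots,x_n)=\max_{i=1}^nZ_i(x_i)$, where each $Z_i:\mathcal{X}_i\to[0,1]$ is surjective, and let $\underline{F}_i(z)=\underline{P}_i(Z_i^{-1}([0,z]))$, $\overline{F}_i(z)=\overline{P}_i(Z_i^{-1}([0,z]))$ for $z\in[0,1]$. The p-box $(\underline{F},\overline{F})$ defined by $$\underline{F}(z)=\prod_{i=1}^n\underline{F}_i(z),\qquad\overline{F}(z)=\prod_{i=1}^n\overline{F}_i(z)$$ is the least conservative p-box on $(\Omega,\preceq)$ whose natural extension $\underline{E}_{\underline{F},\overline{F}}$ is dominated by the independent natural extension $\otimes_{i=1}^n\underline{P}_i$ of $\underline{P}_1,\dots,\underline{P}_n$.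
   Context: $\mathcal{L}(\mathcal{X})$ denotes the set of gambles (bounded real functions) on a set $\mathcal{X}$; events are identified with their indicators. A lower prevision on all gambles on a set is coherent if $\underline{P}(f)\ge\inf f$, $\underline{P}(\lambda f)=\lambda\underline{P}(f)$, $\underline{P}(f+g)\ge\underline{P}(f)+\underline{P}(g)$ for all gambles $f,g$ and $\lambda\ge0$; its conjugate upper prevision is $\overline{P}(f)=-\underline{P}(-f)$. A linear prevision is a functional $Q$ on all gambles with $Q(f)\ge\inf f$ and $Q(f+g)=Q(f)+Q(g)$. The independent natural extension $\otimes_{i=1}^n\underline{P}_i$ models epistemic independence between the variables. For this statement the only facts about it to be used are that it is a coherent lower prevision on $\mathcal{L}(\Omega)$ which, together with its conjugate upper prevision $\otimes_{i=1}^n\overline{P}_i$, satisfies the factorization property $\otimes_{i=1}^n\underline{P}_i(\prod_{i=1}^nA_i)=\prod_{i=1}^n\underline{P}_i(A_i)$ and $\otimes_{i=1}^n\overline{P}_i(\prod_{i=1}^nA_i)=\prod_{i=1}^n\overline{P}_i(A_i)$ for all $A_1\subseteq\mathcal{X}_1,\dots,A_n\subseteq\mathcal{X}_n$; so $\otimes_{i=1}^n\underline{P}_i$ may be taken to be any coherent lower prevision on $\mathcal{L}(\Omega)$ with these properties. The preorder on $\Omega$ is $x\preceq y$ iff $Z(x)\le Z(y)$; $x\prec y$ iff $Z(x)<Z(y)$. $Z$ maps onto $[0,1]$; $0_\Omega$, $1_\Omega$ are elements with $Z$-value $0$ and $1$. $[x,y]=\{v:x\preceq v\preceq y\}$, $(x,y]=\{v:x\prec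 v\preceq y\}$. A cumulative distribution function on $(\Omega,\preceq)$ is a map $F:\Omega\to[0,1]$, non-decreasing with respect to $\preceq$, with $F(1_\Omega)=1$; it is constant on the level sets of $Z$ and is identified with a function of $z=Z(x)\in[0,1]$. A p-box on $(\Omega,\preceq)$ is a pair $(\underline{F},\overline{F})$ of cumulative distribution functions with $\underline{F}\le\overline{F}$. Its natural extension $\underline{E}_{\underline{F},\overline{F}}$ is the pointwise smallest coherent lower prevision $\underline{E}$ on all gambles with $\underline{E}([0_\Omega,x])=\underline{F}(x)$ and $\underline{E}((y,1_\Omega])=1-\overline{F}(y)$ for all $x,y\in\Omega$; equivalently $\underline{E}(f)=\min Q(f)$ over all linear previsions $Q$ on $\mathcal{L}(\Omega)$ with $\underline{F}(z)\le Q(Z^{-1}([0,z]))\le\overline{F}(z)$ for all $z\in[0,1]$. "Dominated by $\underline{P}$" means $\underline{E}_{\underline{F},\overline{F}}(f)\le\underline{P}(f)$ for all gambles $f$ on $\Omega$. "Least conservative" means: the given pair is such a p-box, and every p-box $(\underline{G},\overline{G})$ on $(\Omega,\preceq)$ whose natural extension is dominated by $\underline{P}$ satisfies $\underline{G}\le\underline{F}$ and $\overline{G}\ge\overline{F}$ pointwise. *)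

theory Defs
  imports "HOL-Analysis.Analysis"
begin

definition gambles :: "'a set \<Rightarrow> ('a \<Rightarrow> real) set" where
  "gambles S = {f. bounded (f ` S)}"

text \<open>A functional on the gambles on \<open>S\<close> takes total functions as arguments. The three axioms
  force its value to depend on the restriction of a gamble to \<open>S\<close> only (see \<open>coherent_cong\<close>).\<close>

definition coherent :: "'a set \<Rightarrow> (('a \<Rightarrow> real) \<Rightarrow> real) \<Rightarrow> bool" where
  "coherent S P \<longleftrightarrow>
     (\<forall>f\<in>gambles S. (INF x\<in>S. f x) \<le> P f) \<and>
     (\<forall>f\<in>gambles S. \<forall>c\<ge>0. P (\<lambda>x. c * f x) = c * P f) \<and>
     (\<forall>f\<in>gambles S. \<forall>g\<in>gambles S. P f + P g \<le> P (\<lambda>x. f x + g x))"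

definition conjugate :: "(('a \<Rightarrow> real) \<Rightarrow> real) \<Rightarrow> ('a \<Rightarrow> real) \<Rightarrow> real" where
  "conjugate P f = - P (\<lambda>x. - f x)"

definition dominated_by ::
    "'a set \<Rightarrow> (('a \<Rightarrow> real) \<Rightarrow> real) \<Rightarrow> (('a \<Rightarrow> real) \<Rightarrow> real) \<Rightarrow> bool" where
  "dominated_by S E P \<longleftrightarrow> (\<forall>f\<in>gambles S. E f \<le> P f)"

text \<open>The total preorder on \<open>S\<close> is the one induced by \<open>Z\<close>, which maps \<open>S\<close> onto the unit interval.
  The smallest and largest elements \<open>0\<close> and \<open>1\<close> of \<open>S\<close> are any elements with \<open>Z\<close>-value 0 and 1, so
  that \<open>{v \<in> S. 0 \<le> Z v \<and> Z v \<le> Z x}\<close> is the order interval \<open>[0, x]\<close> and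
  \<open>{v \<in> S. Z y < Z v \<and> Z v \<le> 1}\<close> is the order interval \<open>(y, 1]\<close>.\<close>

definition is_cdf :: "'a set \<Rightarrow> ('a \<Rightarrow> real) \<Rightarrow> ('a \<Rightarrow> real) \<Rightarrow> bool" where
  "is_cdf S Z F \<longleftrightarrow>
     (\<forall>x\<in>S. F x \<in> {0..1}) \<and>
     (\<forall>x\<in>S. \<forall>y\<in>S. Z x \<le> Z y \<longrightarrow> F x \<le> F y) \<and>
     (\<forall>x\<in>S. Z x = 1 \<longrightarrow> F x = 1)"

definition is_pbox :: "'a set \<Rightarrow> ('a \<Rightarrow> real) \<Rightarrow> ('a \<Rightarrow> real) \<Rightarrow> ('a \<Rightarrow> real) \<Rightarrow> bool" where
  "is_pbox S Z Fl Fu \<longleftrightarrow> is_cdf S Z Fl \<and> is_cdf S Z Fu \<and> (\<forall>x\<in>S. Fl x \<le> Fu x)"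

definition extends_pbox ::
    "'a set \<Rightarrow> ('a \<Rightarrow> real) \<Rightarrow> ('a \<Rightarrow> real) \<Rightarrow> ('a \<Rightarrow> real) \<Rightarrow> (('a \<Rightarrow> real) \<Rightarrow> real) \<Rightarrow> bool" where
  "extends_pbox S Z Fl Fu E \<longleftrightarrow>
     (\<forall>x\<in>S. E (indicator {v \<in> S. 0 \<le> Z v \<and> Z v \<le> Z x}) = Fl x) \<and>
     (\<forall>y\<in>S. E (indicator {v \<in> S. Z y < Z v \<and> Z v \<le> 1}) = 1 - Fu y)"

text \<open>The natural extension is unique on the gambles on \<open>S\<close>, but its values on unbounded functions
  are not determined; hence a predicate.\<close>

definition is_natural_extension ::
    "'a set \<Rightarrow> ('a \<Rightarrow> real) \<Rightarrow> ('a \<Rightarrow> real) \<Rightarrow> ('a \<Rightarrow> real) \<Rightarrow> (('a \<Rightarrow> real) \<Rightarrow> real) \<Rightarrow> bool" where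
  "is_natural_extension S Z Fl Fu E \<longleftrightarrow>
     coherent S E \<and> extends_pbox S Z Fl Fu E \<and>
     (\<forall>E'. coherent S E' \<and> extends_pbox S Z Fl Fu E' \<longrightarrow> dominated_by S E E')"

definition pbox_dominated_by ::
    "'a set \<Rightarrow> ('a \<Rightarrow> real) \<Rightarrow> ('a \<Rightarrow> real) \<Rightarrow> ('a \<Rightarrow> real) \<Rightarrow> (('a \<Rightarrow> real) \<Rightarrow> real) \<Rightarrow> bool" where
  "pbox_dominated_by S Z Fl Fu P \<longleftrightarrow>
     is_pbox S Z Fl Fu \<and> (\<exists>E. is_natural_extension S Z Fl Fu E \<and> dominated_by S E P)"

definition least_conservative_pbox ::
    "'a set \<Rightarrow> ('a \<Rightarrow> real) \<Rightarrow> ('a \<Rightarrow> real) \<Rightarrow> ('a \<Rightarrow> real) \<Rightarrow> (('a \<Rightarrow> real) \<Rightarrow> real) \<Rightarrow> bool" where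
  "least_conservative_pbox S Z Fl Fu P \<longleftrightarrow>
     pbox_dominated_by S Z Fl Fu P \<and>
     (\<forall>Gl Gu. pbox_dominated_by S Z Gl Gu P \<longrightarrow> (\<forall>x\<in>S. Gl x \<le> Fl x \<and> Fu x \<le> Gu x))"

definition distribution ::
    "'a set \<Rightarrow> ('a \<Rightarrow> real) \<Rightarrow> (('a \<Rightarrow> real) \<Rightarrow> real) \<Rightarrow> real \<Rightarrow> real" where
  "distribution S Z P z = P (indicator (Z -` {0..z} \<inter> S))"

definition max_rank :: "nat \<Rightarrow> (nat \<Rightarrow> 'a \<Rightarrow> real) \<Rightarrow> (nat \<Rightarrow> 'a) \<Rightarrow> real" where
  "max_rank n Z x = (MAX i\<in>{1..n}. Z i (x i))"

lemma gambles_add: "f \<in> gambles S \<Longrightarrow> g \<in> gambles S \<Longrightarrow> (\<lambda>x. f x + g x) \<in> gambles S"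
  unfolding gambles_def by (simp add: bounded_plus_comp)

lemma gambles_minus: "f \<in> gambles S \<Longrightarrow> g \<in> gambles S \<Longrightarrow> (\<lambda>x. f x - g x) \<in> gambles S"
  unfolding gambles_def by (simp add: bounded_minus_comp)

lemma coherent_mono:
  assumes "coherent S P" "S \<noteq> {}" "f \<in> gambles S" "g \<in> gambles S" "\<And>x. x \<in> S \<Longrightarrow> f x \<le> g x"
  shows "P f \<le> P g"
proof -
  let ?d = "\<lambda>x. g x - f x"
  have d: "?d \<in> gambles S" using assms by (intro gambles_minus)
  have "0 \<le> (INF x\<in>S. ?d x)" using assms(2,5) by (intro cINF_greatest) auto
  also have "\<dots> \<le> P ?d" using assms(1) d by (simp add: coherent_def)
  finally have "P f \<le> P f + P ?d" by simp
  also have "\<dots> \<le> P (\<lambda>x. f x + ?d x)"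
    using assms(1) assms(3) d unfolding coherent_def by blast
  finally show ?thesis by simp
qed

lemma coherent_cong:
  assumes "coherent S P" "S \<noteq> {}" "f \<in> gambles S" "\<And>x. x \<in> S \<Longrightarrow> f x = g x"
  shows "P f = P g"
proof -
  have "f ` S = g ` S" using assms(4) by (rule image_cong[OF refl])
  then have "g \<in> gambles S" using assms(3) by (simp add: gambles_def)
  then show ?thesis
    using coherent_mono[OF assms(1,2), of f g] coherent_mono[OF assms(1,2), of g f] assms(3,4)
    by fastforce
qed

lemma natural_extension_unique:
  assumes "is_natural_extension S Z Fl Fu E" "is_natural_extension S Z Fl Fu E'" "f \<in> gambles S"
  shows "E f = E' f"
  using assms unfolding is_natural_extension_def dominated_by_def by (meson order_antisym)

end

theory Submission
  imports Defs
begin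

text \<open>Every coherent lower prevision \<open>P\<close> on \<open>S\<close> induces a p-box on \<open>(S, Z)\<close>, namely
  \<open>(P [0, x], conjugate P [0, x])\<close>, and this is always the least conservative p-box whose natural
  extension \<open>P\<close> dominates: \<open>P\<close> is itself one of the coherent extensions of this p-box, so that it
  dominates their lower envelope, which is the natural extension; and the bounds \<open>Gl x\<close> and
  \<open>1 - Gu y\<close> of any other p-box are the values of its natural extension at \<open>[0, x]\<close> and \<open>(y, 1]\<close>,
  where the values of \<open>P\<close> are \<open>P [0, x]\<close> and \<open>1 - conjugate P [0, y]\<close>. This is
  \<open>induced_pbox_least_conservative\<close>.

  It remains to compute the p-box that the independent natural extension induces. Since a maximum
  is at most \<open>z\<close> precisely if all its entries are, the interval \<open>[0, x]\<close> of the maximum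
  preorder is a product of events (\<open>max_rank_interval\<close>), and the factorization property turns its
  lower and upper probability into products of the marginal distribution functions.\<close>

section \<open>Coherent lower previsions\<close>

lemma gambles_const [simp]: "(\<lambda>_. c) \<in> gambles S"
  unfolding gambles_def by (rule CollectI, rule bounded_subset[of "{c}"]) auto

lemma gambles_cmult: "f \<in> gambles S \<Longrightarrow> (\<lambda>x. c * f x) \<in> gambles S"
  unfolding gambles_def using bounded_scaling[of "f ` S" c] by (simp add: image_image)

lemma gambles_uminus: "f \<in> gambles S \<Longrightarrow> (\<lambda>x. - f x) \<in> gambles S"
  using gambles_cmult[of f S "-1"] by simp

lemma gambles_indicator [simp]: "indicator A \<in> gambles S"
  unfolding gambles_def
  by (rule CollectI, rule bounded_subset[of "{0, 1}"]) (auto simp: indicator_def)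

lemma coherent_const:
  assumes "coherent S P" "S \<noteq> {}"
  shows "P (\<lambda>_. c) = c"
proof -
  have lower: "d \<le> P (\<lambda>_. d)" for d :: real
  proof -
    have "(INF x\<in>S. d) \<le> P (\<lambda>_. d)"
      using assms(1) gambles_const[of d S] unfolding coherent_def by blast
    then show ?thesis using assms(2) by simp
  qed
  have add: "P (\<lambda>_. c) + P (\<lambda>_. - c) \<le> P (\<lambda>_. c + - c)"
    using assms(1) gambles_const[of c S] gambles_const[of "- c" S] unfolding coherent_def by blast
  have "\<forall>f\<in>gambles S. \<forall>d\<ge>0. P (\<lambda>x. d * f x) = d * P f"
    using assms(1) by (simp add: coherent_def)
  from bspec[OF this gambles_const[of c]]
  have "P (\<lambda>_. 0) = 0" by (metis mult_zero_left order_refl)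
  with add show ?thesis using lower[of c] lower[of "- c"] by simp
qed

lemma coherent_add_const:
  assumes "coherent S P" "S \<noteq> {}" "f \<in> gambles S"
  shows "P (\<lambda>x. f x + c) = P f + c"
proof (rule antisym)
  have super: "P g + P (\<lambda>_. d) \<le> P (\<lambda>x. g x + d)" if "g \<in> gambles S" for g d
    using assms(1) that gambles_const[of d S] unfolding coherent_def by blast
  show "P f + c \<le> P (\<lambda>x. f x + c)"
    using super[OF assms(3), of c] coherent_const[OF assms(1,2)] by simp
  have "(\<lambda>x. f x + c) \<in> gambles S" using assms(3) by (intro gambles_add) auto
  from super[OF this, of "- c"] show "P (\<lambda>x. f x + c) \<le> P f + c"
    using coherent_const[OF assms(1,2)] by simp
qed

lemma coherent_le_conjugate:
  assumes "coherent S P" "S \<noteq> {}" "f \<in> gambles S"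
  shows "P f \<le> conjugate P f"
proof -
  have "P f + P (\<lambda>x. - f x) \<le> P (\<lambda>x. f x + - f x)"
    using assms(1,3) gambles_uminus[OF assms(3)] unfolding coherent_def by blast
  then show ?thesis using coherent_const[OF assms(1,2), of 0] by (simp add: conjugate_def)
qed

lemma conjugate_mono:
  assumes "coherent S P" "S \<noteq> {}" "f \<in> gambles S" "g \<in> gambles S" "\<And>x. x \<in> S \<Longrightarrow> f x \<le> g x"
  shows "conjugate P f \<le> conjugate P g"
  unfolding conjugate_def neg_le_iff_le
  by (intro coherent_mono[OF assms(1,2)] gambles_uminus assms(3,4)) (simp add: assms(5))

lemma coherent_indicator_complement:
  assumes "coherent S P" "S \<noteq> {}" "A \<subseteq> S"
  shows "P (indicator (S - A)) = 1 - conjugate P (indicator A)"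
proof -
  have "P (indicator (S - A)) = P (\<lambda>x. - indicator A x + 1)"
    using assms by (intro coherent_cong[OF assms(1,2)]) (auto simp: indicator_def)
  also have "\<dots> = P (\<lambda>x. - indicator A x) + 1"
    by (intro coherent_add_const[OF assms(1,2)] gambles_uminus gambles_indicator)
  finally show ?thesis by (simp add: conjugate_def)
qed

lemma coherent_indicator_space:
  assumes "coherent S P" "S \<noteq> {}"
  shows "P (indicator S) = 1" "conjugate P (indicator S) = 1"
proof -
  show "P (indicator S) = 1"
    using coherent_cong[OF assms, of "indicator S" "\<lambda>_. 1"] coherent_const[OF assms, of 1] by simp
  have "P (indicator (S - S)) = 0"
    using coherent_const[OF assms, of 0]
    by (simp add: indicator_def[abs_def])
  then show "conjugate P (indicator S) = 1"
    using coherent_indicator_complement[OF assms, of S] by simp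
qed

text \<open>A lower envelope is coherent because an infimum of sums is at least the sum of the infima,
  while bounds from below and nonnegative factors pass through an infimum.\<close>

lemma coherent_lower_envelope:
  assumes "M \<noteq> {}" "\<And>P. P \<in> M \<Longrightarrow> coherent S P"
  shows "coherent S (\<lambda>f. INF P\<in>M. P f)"
proof -
  have bound: "(INF x\<in>S. f x) \<le> P f" if "P \<in> M" "f \<in> gambles S" for P f
    using assms(2)[OF that(1)] that(2) unfolding coherent_def by blast
  have bdd: "bdd_below ((\<lambda>P. P f) ` M)" if "f \<in> gambles S" for f
    using bound that by (intro bdd_belowI2)
  have hom: "(INF P\<in>M. P (\<lambda>x. c * f x)) = c * (INF P\<in>M. P f)"
    if "f \<in> gambles S" "c \<ge> 0" for f c
  proof -
    have "(INF P\<in>M. P (\<lambda>x. c * f x)) = (INF P\<in>M. c * P f)"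
      using assms(2) that unfolding coherent_def by (intro INF_cong) auto
    also have "\<dots> = c * (INF P\<in>M. P f)"
    proof (rule sym)
      have "continuous (at_right (INF P\<in>M. P f)) (\<lambda>t. c * t)"
        by (intro continuous_intros)
      moreover have "mono (\<lambda>t::real. c * t)"
        using that(2) by (intro monoI mult_left_mono)
      ultimately show "c * (INF P\<in>M. P f) = (INF P\<in>M. c * P f)"
        using continuous_at_Inf_mono[of "\<lambda>t. c * t" "(\<lambda>P. P f) ` M"] assms(1) bdd[OF that(1)]
        by (simp add: image_image)
    qed
    finally show ?thesis .
  qed
  have super: "(INF P\<in>M. P f) + (INF P\<in>M. P g) \<le> (INF P\<in>M. P (\<lambda>x. f x + g x))"
    if "f \<in> gambles S" "g \<in> gambles S" for f g
  proof (rule cINF_greatest[OF assms(1)])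
    fix P assume P: "P \<in> M"
    have "(INF P\<in>M. P f) + (INF P\<in>M. P g) \<le> P f + P g"
      using bdd that P by (intro add_mono cINF_lower)
    also have "\<dots> \<le> P (\<lambda>x. f x + g x)"
      using assms(2)[OF P] that unfolding coherent_def by blast
    finally show "(INF P\<in>M. P f) + (INF P\<in>M. P g) \<le> P (\<lambda>x. f x + g x)" .
  qed
  show ?thesis
    unfolding coherent_def using hom super bound assms(1) by (auto intro!: cINF_greatest)
qed

section \<open>The p-box induced by a coherent lower prevision\<close>

text \<open>The natural extension is the lower envelope of all coherent extensions; all of them take the
  same values on the events that the p-box constrains, and so does the envelope.\<close>

lemma natural_extension_exists:
  assumes "coherent S P" "extends_pbox S Z Fl Fu P"
  obtains E where "is_natural_extension S Z Fl Fu E"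
proof -
  define M where "M = {P. coherent S P \<and> extends_pbox S Z Fl Fu P}"
  define E where "E = (\<lambda>f. INF P\<in>M. P f)"
  have ne: "M \<noteq> {}" using assms by (auto simp: M_def)
  have coh: "coherent S E"
    unfolding E_def using ne by (rule coherent_lower_envelope) (simp add: M_def)
  have "E f = c" if "\<And>P. P \<in> M \<Longrightarrow> P f = c" for f c
  proof -
    have "(INF P\<in>M. P f) = (INF P\<in>M. c)" using that by (intro INF_cong) auto
    then show ?thesis using ne by (simp add: E_def)
  qed
  then have ext: "extends_pbox S Z Fl Fu E"
    unfolding extends_pbox_def by (simp add: M_def extends_pbox_def)
  have "dominated_by S E P'" if "P' \<in> M" for P'
    unfolding dominated_by_def
  proof
    fix f assume f: "f \<in> gambles S"
    have "bdd_below ((\<lambda>P. P f) ` M)"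
      using f by (intro bdd_belowI2[of _ "INF x\<in>S. f x"]) (auto simp: M_def coherent_def)
    then show "E f \<le> P' f" unfolding E_def using that by (rule cINF_lower)
  qed
  with coh ext have "is_natural_extension S Z Fl Fu E"
    by (simp add: is_natural_extension_def M_def)
  then show ?thesis by (rule that)
qed

text \<open>The values of \<open>P\<close> at the intervals \<open>[0, x]\<close> and \<open>(y, 1]\<close> bound every p-box that \<open>P\<close>
  dominates, and the p-box with precisely these values is dominated because \<open>P\<close> extends it.\<close>

lemma induced_pbox_least_conservative:
  assumes P: "coherent S P" and ne: "S \<noteq> {}" and Z: "Z ` S \<subseteq> {0..1}"
  shows "least_conservative_pbox S Z
           (\<lambda>x. distribution S Z P (Z x)) (\<lambda>x. distribution S Z (conjugate P) (Z x)) P"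
    (is "least_conservative_pbox S Z ?Fl ?Fu P")
proof -
  have lower: "P (indicator {v \<in> S. 0 \<le> Z v \<and> Z v \<le> Z x}) = ?Fl x" for x
    by (simp add: distribution_def) (rule arg_cong[where f = "\<lambda>A. P (indicator A)"], auto)
  have upper: "P (indicator {v \<in> S. Z y < Z v \<and> Z v \<le> 1}) = 1 - ?Fu y" for y
  proof -
    have "{v \<in> S. Z y < Z v \<and> Z v \<le> 1} = S - (Z -` {0..Z y} \<inter> S)"
      using Z by force
    then show ?thesis
      using coherent_indicator_complement[OF P ne, of "Z -` {0..Z y} \<inter> S"]
      by (simp add: distribution_def)
  qed
  have ext: "extends_pbox S Z ?Fl ?Fu P"
    by (simp add: extends_pbox_def lower upper)

  have le: "?Fl x \<le> ?Fu x" for x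
    unfolding distribution_def by (rule coherent_le_conjugate[OF P ne gambles_indicator])
  have mono: "?Fl x \<le> ?Fl y" "?Fu x \<le> ?Fu y" if "Z x \<le> Z y" for x y
    unfolding distribution_def using that
    by (auto intro!: coherent_mono[OF P ne] conjugate_mono[OF P ne] simp: indicator_def)
  have nonneg: "0 \<le> ?Fl x" for x
  proof -
    have "P (\<lambda>_. 0) \<le> ?Fl x"
      unfolding distribution_def by (intro coherent_mono[OF P ne]) auto
    then show ?thesis using coherent_const[OF P ne, of 0] by simp
  qed
  have le_1: "?Fu x \<le> 1" for x
  proof -
    have "?Fu x \<le> conjugate P (indicator S)"
      unfolding distribution_def by (intro conjugate_mono[OF P ne]) (auto simp: indicator_def)
    then show ?thesis using coherent_indicator_space[OF P ne] by simp
  qed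
  have top: "?Fl x = 1" "?Fu x = 1" if "Z x = 1" for x
  proof -
    have "Z -` {0..Z x} \<inter> S = S" using Z that by auto
    then show "?Fl x = 1" "?Fu x = 1"
      using coherent_indicator_space[OF P ne] by (simp_all add: distribution_def)
  qed
  have range: "?Fl x \<in> {0..1}" "?Fu x \<in> {0..1}" for x
    using le[of x] nonneg[of x] le_1[of x] by auto
  have pbox: "is_pbox S Z ?Fl ?Fu"
    unfolding is_pbox_def is_cdf_def using le mono top range by blast

  obtain E where E: "is_natural_extension S Z ?Fl ?Fu E"
    using natural_extension_exists[OF P ext] .
  then have "dominated_by S E P"
    using P ext by (simp add: is_natural_extension_def)
  with pbox E have "pbox_dominated_by S Z ?Fl ?Fu P"
    by (auto simp: pbox_dominated_by_def)
  moreover have "Gl x \<le> ?Fl x \<and> ?Fu x \<le> Gu x"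
    if G: "pbox_dominated_by S Z Gl Gu P" and x: "x \<in> S" for Gl Gu x
  proof -
    obtain E where E: "extends_pbox S Z Gl Gu E" "dominated_by S E P"
      using G by (auto simp: pbox_dominated_by_def is_natural_extension_def)
    have "E (indicator A) \<le> P (indicator A)" for A
      using E(2) by (simp add: dominated_by_def)
    from this[of "{v \<in> S. 0 \<le> Z v \<and> Z v \<le> Z x}"] this[of "{v \<in> S. Z x < Z v \<and> Z v \<le> 1}"]
    show ?thesis
      using E(1) x unfolding lower upper extends_pbox_def by simp
  qed
  ultimately show ?thesis by (auto simp: least_conservative_pbox_def)
qed

section \<open>The maximum preorder on a product\<close>

lemma max_rank_le_iff:
  assumes "n \<ge> 1"
  shows "max_rank n Z x \<le> z \<longleftrightarrow> (\<forall>i\<in>{1..n}. Z i (x i) \<le> z)"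
  using assms unfolding max_rank_def by (subst Max_le_iff) auto

lemma max_rank_ge:
  assumes "i \<in> {1..n}"
  shows "Z i (x i) \<le> max_rank n Z x"
  using assms unfolding max_rank_def by (intro Max_ge) auto

lemma max_rank_in_unit:
  assumes "n \<ge> 1" "\<And>i. i \<in> {1..n} \<Longrightarrow> Z i (x i) \<in> {0..1}"
  shows "max_rank n Z x \<in> {0..1}"
proof -
  have "0 \<le> Z 1 (x 1)" "Z 1 (x 1) \<le> max_rank n Z x"
    using assms(1) assms(2)[of 1] max_rank_ge[of 1 n Z x] by auto
  moreover have "max_rank n Z x \<le> 1"
    using assms by (simp add: max_rank_le_iff)
  ultimately show ?thesis by simp
qed

text \<open>The lower bound \<open>0\<close> holds automatically on both sides, and a maximum respects the upper
  bound \<open>z\<close> precisely if every coordinate does. This is what makes the factorization property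
  applicable.\<close>

lemma max_rank_interval:
  assumes "n \<ge> 1" "\<And>i. i \<in> {1..n} \<Longrightarrow> Z i ` X i \<subseteq> {0..1}"
  shows "max_rank n Z -` {0..z} \<inter> PiE {1..n} X = PiE {1..n} (\<lambda>i. Z i -` {0..z} \<inter> X i)"
proof (rule set_eqI)
  fix x
  have "0 \<le> Z i (x i)" "0 \<le> max_rank n Z x" if "x \<in> PiE {1..n} X" "i \<in> {1..n}" for i
  proof -
    have "Z j (x j) \<in> {0..1}" if "j \<in> {1..n}" for j
      using assms(2)[OF that] PiE_mem[OF \<open>x \<in> PiE {1..n} X\<close> that] by blast
    then show "0 \<le> Z i (x i)" "0 \<le> max_rank n Z x"
      using that(2) max_rank_in_unit[of n Z x] assms(1) by auto
  qed
  moreover have "x \<in> PiE {1..n} (\<lambda>i. Z i -` {0..z} \<inter> X i) \<longleftrightarrow>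
      x \<in> PiE {1..n} X \<and> (\<forall>i\<in>{1..n}. 0 \<le> Z i (x i) \<and> Z i (x i) \<le> z)"
    by (auto simp: PiE_iff)
  moreover have "1 \<in> {1..n}" using assms(1) by simp
  ultimately show "x \<in> max_rank n Z -` {0..z} \<inter> PiE {1..n} X \<longleftrightarrow>
      x \<in> PiE {1..n} (\<lambda>i. Z i -` {0..z} \<inter> X i)"
    using max_rank_le_iff[OF assms(1), of Z x z] by auto
qed

text \<open>The functional \<open>R\<close> is arbitrary because this serves both a lower prevision and its conjugate,
  which need not be coherent.\<close>

lemma distribution_max_rank:
  assumes "n \<ge> 1" "\<And>i. i \<in> {1..n} \<Longrightarrow> Z i ` X i \<subseteq> {0..1}"
    and factor: "\<And>A. (\<And>i. i \<in> {1..n} \<Longrightarrow> A i \<subseteq> X i) \<Longrightarrow>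
           R (indicator (PiE {1..n} A)) = (\<Prod>i=1..n. p i (indicator (A i)))"
  shows "distribution (PiE {1..n} X) (max_rank n Z) R z =
           (\<Prod>i=1..n. distribution (X i) (Z i) (p i) z)"
  using factor[of "\<lambda>i. Z i -` {0..z} \<inter> X i"] max_rank_interval[of n Z X z, OF assms(1,2)]
  by (simp add: distribution_def)

section \<open>The p-box of the independent natural extension\<close>

theorem theorem25:
  fixes n :: nat
    and X :: "nat \<Rightarrow> 'a set"
    and Z :: "nat \<Rightarrow> 'a \<Rightarrow> real"
    and P :: "nat \<Rightarrow> ('a \<Rightarrow> real) \<Rightarrow> real"
    and Q :: "((nat \<Rightarrow> 'a) \<Rightarrow> real) \<Rightarrow> real"
  assumes "n \<ge> 1"
    and "\<And>i. i \<in> {1..n} \<Longrightarrow> coherent (X i) (P i)"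
    and "\<And>i. i \<in> {1..n} \<Longrightarrow> Z i ` X i = {0..1}"
    and "coherent (PiE {1..n} X) Q"
    and "\<And>A. (\<And>i. i \<in> {1..n} \<Longrightarrow> A i \<subseteq> X i) \<Longrightarrow>
           Q (indicator (PiE {1..n} A)) = (\<Prod>i=1..n. P i (indicator (A i)))"
    and "\<And>A. (\<And>i. i \<in> {1..n} \<Longrightarrow> A i \<subseteq> X i) \<Longrightarrow>
           conjugate Q (indicator (PiE {1..n} A)) = (\<Prod>i=1..n. conjugate (P i) (indicator (A i)))"
  shows "least_conservative_pbox (PiE {1..n} X) (max_rank n Z)
           (\<lambda>x. \<Prod>i=1..n. distribution (X i) (Z i) (P i) (max_rank n Z x))
           (\<lambda>x. \<Prod>i=1..n. distribution (X i) (Z i) (conjugate (P i)) (max_rank n Z x))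
           Q"
proof -
  have Z: "Z i ` X i \<subseteq> {0..1}" if "i \<in> {1..n}" for i
    using assms(3)[OF that] by simp
  have "X i \<noteq> {}" if "i \<in> {1..n}" for i
    using assms(3)[OF that] by fastforce
  then have ne: "PiE {1..n} X \<noteq> {}" by (simp add: PiE_eq_empty_iff)
  have "max_rank n Z ` PiE {1..n} X \<subseteq> {0..1}"
  proof (rule image_subsetI)
    fix x assume x: "x \<in> PiE {1..n} X"
    show "max_rank n Z x \<in> {0..1}"
    proof (rule max_rank_in_unit[OF assms(1)])
      fix i assume i: "i \<in> {1..n}"
      show "Z i (x i) \<in> {0..1}" using Z[OF i] PiE_mem[OF x i] by blast
    qed
  qed
  from induced_pbox_least_conservative[OF assms(4) ne this] show ?thesis
    by (simp only:
        distribution_max_rank[where R = Q and p = P, OF assms(1) Z assms(5)]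
        distribution_max_rank[where R = "conjugate Q" and p = "\<lambda>i. conjugate (P i)",
          OF assms(1) Z assms(6)])
qed

end
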